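(* Let $m,n\ge1$. The number of hyposylvester classes of $m$-permutations of $n$ is $(m+1)^{n-1}$.
   Context: An $m$-permutation of $n$ is a word over $\{1,\dots,n\}$ in which each letter $1,\dots,n$ occurs exactly $m$ times. The hyposylvester congruence is the equivalence relation on words over the positive integers generated by: (1) $w=x\,ac\,y\equiv x\,ca\,y$ for letters $a<c$ and words $x,y$, whenever some letter $b$ with $a<b<c$ occurs (anywhere) in $w$; (2) $x\,ab\,y\,a\,z\equiv x\,ba\,y\,a\,z$ for letters $a<b$ and words $x,y,z$. *)

theory Defs
  imports Main
begin

definition words :: "nat list set" where
  "words = {w. \<forall>i \<in> set w. 1 \<le> i}"

definition m_permutations :: "nat \<Rightarrow> nat \<Rightarrow> nat list set" where
  "m_permutations m n = {w. set w \<subseteq> {1..n} \<and> (\<forall>i \<in> {1..n}. count_list w i = m)}"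

text \<open>The two generating relations, each oriented from left to right. In the first one the
  witness \<open>b\<close> may occur anywhere in the word; it cannot be one of the two displayed letters.\<close>

inductive hyposylvester_step :: "nat list \<Rightarrow> nat list \<Rightarrow> bool" where
  step_ac: "\<lbrakk>a < b; b < c; b \<in> set (x @ [a, c] @ y)\<rbrakk>
    \<Longrightarrow> hyposylvester_step (x @ [a, c] @ y) (x @ [c, a] @ y)"
| step_ab: "a < b
    \<Longrightarrow> hyposylvester_step (x @ [a, b] @ y @ [a] @ z) (x @ [b, a] @ y @ [a] @ z)"

text \<open>Steps only permute the letters of a word, so they never leave \<open>words\<close>; restricting the
  generated equivalence to \<open>words\<close> only excludes the letter \<open>0\<close>.\<close>

definition hyposylvester :: "(nat list \<times> nat list) set" where
  "hyposylvester = {(u, v). u \<in> words \<and> v \<in> words \<and> equivclp hyposylvester_step u v}"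

lemma equiv_hyposylvester: "equiv words hyposylvester"
  unfolding hyposylvester_def
  by (rule equivI)
    (auto simp: refl_on_def sym_def trans_def intro: equivclp_sym equivclp_trans)

end

(* In an m-permutation, a letter can be pushed through every letter except an adjacent one, and
   (i+1) can be pushed through i as long as another i follows. Hence the largest letter n+1 can be
   moved to the two ends of the word, those copies before the last n going to the front and the
   others to the back. Inductively, the number of copies of i+1 after the last i, for 1 <= i < n,
   determines the class. These numbers are invariants of the two generating relations, and they
   take all values between 0 and m independently. *)

theory Submission
  imports Defs "HOL-Library.FuncSet"
begin

section \<open>Compatibility with concatenation\<close>

abbreviation hypo_equiv :: "nat list \<Rightarrow> nat list \<Rightarrow> bool" (infix "\<approx>" 50) where
  "u \<approx> v \<equiv> equivclp hyposylvester_step u v"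

text \<open>Extra letters destroy neither the witness \<open>b\<close>, which may stand anywhere,
  nor the later copy of \<open>a\<close>.\<close>

lemma hyposylvester_step_context:
  "hyposylvester_step u v \<Longrightarrow> hyposylvester_step (p @ u @ q) (p @ v @ q)"
proof (induction rule: hyposylvester_step.induct)
  case (step_ac a b c x y)
  then show ?case
    using hyposylvester_step.step_ac[of a b c "p @ x" "y @ q"] by auto
next
  case (step_ab a b x y z)
  then show ?case
    using hyposylvester_step.step_ab[of a b "p @ x" y "z @ q"] by simp
qed

lemma hypo_equiv_context: "u \<approx> v \<Longrightarrow> p @ u @ q \<approx> p @ v @ q"
proof (induction rule: equivclp_induct)
  case base
  show ?case by simp
next
  case (step y z)
  then have "p @ y @ q \<approx> p @ z @ q"
    by (metis hyposylvester_step_context r_into_equivclp equivclp_sym)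
  with step.IH show ?case by (rule equivclp_trans)
qed

section \<open>Moving the largest letter\<close>

text \<open>\<open>Suc b\<close> passes the letters of \<open>t\<close> one by one: for
  \<open>a < b\<close> the letter \<open>b\<close> is the intermediate witness, for
  \<open>a = b\<close> a later \<open>b\<close> allows the swap. Asking for these copies outside
  \<open>t\<close> keeps the hypothesis valid as letters move from \<open>t\<close> to
  \<open>x\<close>.\<close>

lemma push_letter_right:
  assumes "\<And>a. a \<in> set t \<Longrightarrow> a \<le> b \<and> b \<in> set (if a < b then x @ y else y)"
  shows "x @ [Suc b] @ t @ y \<approx> x @ t @ [Suc b] @ y"
  using assms
proof (induction t arbitrary: x)
  case Nil
  show ?case by simp
next
  case (Cons a t)
  have a: "a \<le> b" "b \<in> set (if a < b then x @ y else y)"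
    using Cons.prems[of a] by auto
  have "hyposylvester_step (x @ [a, Suc b] @ t @ y) (x @ [Suc b, a] @ t @ y)"
  proof (cases "a < b")
    case True
    with a show ?thesis by (intro step_ac[of a b]) auto
  next
    case False
    with a have "a = b" "b \<in> set y" by auto
    moreover from this obtain y1 y2 where "y = y1 @ b # y2"
      by (blast dest: split_list)
    ultimately show ?thesis
      using step_ab[of b "Suc b" x "t @ y1" y2] by simp
  qed
  then have "x @ [Suc b] @ (a # t) @ y \<approx> (x @ [a]) @ [Suc b] @ t @ y"
    by (auto intro: equivclp_sym)
  also have "(x @ [a]) @ [Suc b] @ t @ y \<approx> (x @ [a]) @ t @ [Suc b] @ y"
    by (rule Cons.IH) (use Cons.prems in \<open>fastforce split: if_splits\<close>)
  finally (equivclp_trans) show ?case by simp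
qed

lemma push_max_to_front:
  assumes "\<And>a. a \<in> set u \<Longrightarrow> a \<le> Suc b" and "b \<in> set y"
  shows "u @ y \<approx> filter ((=) (Suc b)) u @ filter ((\<noteq>) (Suc b)) u @ y"
  using assms
proof (induction u arbitrary: y rule: rev_induct)
  case Nil
  show ?case by simp
next
  case (snoc a u)
  let ?f = "filter ((=) (Suc b)) u" and ?g = "filter ((\<noteq>) (Suc b)) u"
  have IH: "u @ a # y \<approx> ?f @ ?g @ a # y"
    using snoc.IH[of "a # y"] snoc.prems by simp
  show ?case
  proof (cases "a = Suc b")
    case True
    \<comment> \<open>This copy has to go left, so the push to the right is read backwards.\<close>
    have "?f @ [Suc b] @ ?g @ y \<approx> ?f @ ?g @ [Suc b] @ y"
      by (rule push_letter_right) (use snoc.prems in \<open>fastforce simp: le_Suc_eq\<close>)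
    with IH True show ?thesis
      by (auto intro: equivclp_trans equivclp_sym)
  next
    case False
    with IH show ?thesis by simp
  qed
qed

text \<open>No \<open>b\<close> has to be passed here, so the first relation suffices, with the
  \<open>b\<close> in \<open>x\<close> as witness.\<close>

lemma push_max_to_back:
  assumes "\<And>a. a \<in> set v \<Longrightarrow> a \<le> Suc b" and "b \<in> set x" and "b \<notin> set v"
  shows "x @ v \<approx> x @ filter ((\<noteq>) (Suc b)) v @ filter ((=) (Suc b)) v"
  using assms
proof (induction v arbitrary: x)
  case Nil
  show ?case by simp
next
  case (Cons a v)
  let ?f = "filter ((=) (Suc b)) v" and ?g = "filter ((\<noteq>) (Suc b)) v"
  have IH: "x @ a # v \<approx> x @ a # ?g @ ?f"
    using Cons.IH[of "x @ [a]"] Cons.prems by simp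
  show ?case
  proof (cases "a = Suc b")
    case True
    have "x @ [Suc b] @ ?g @ ?f \<approx> x @ ?g @ [Suc b] @ ?f"
      by (rule push_letter_right) (use Cons.prems in \<open>fastforce simp: le_Suc_eq\<close>)
    with IH True show ?thesis
      by (auto intro: equivclp_trans)
  next
    case False
    with IH show ?thesis by simp
  qed
qed

section \<open>The invariants\<close>

definition tail_count :: "nat \<Rightarrow> nat \<Rightarrow> nat list \<Rightarrow> nat" where
  "tail_count a b w = count_list (takeWhile ((\<noteq>) a) (rev w)) b"

lemma tail_count_append:
  "tail_count a b (u @ v) =
    (if a \<in> set v then tail_count a b v else count_list v b + tail_count a b u)"
  by (auto simp: tail_count_def takeWhile_append)

lemma tail_count_Cons:
  "tail_count a b (x # v) =
    (if a \<in> set v then tail_count a b v else count_list v b + (if x = b \<and> x \<noteq> a then 1 else 0))"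
proof -
  have "tail_count a b [x] = (if x = b \<and> x \<noteq> a then 1 else 0)"
    unfolding tail_count_def by (cases "x = a") simp_all
  then show ?thesis
    using tail_count_append[of a b "[x]" v] by simp
qed

lemma tail_count_notin: "a \<notin> set w \<Longrightarrow> tail_count a b w = count_list w b"
  by (induction w) (auto simp: tail_count_Cons tail_count_def[of _ _ "[]"])

text \<open>Only letters other than \<open>a\<close> and \<open>b\<close> are deleted. This allows
  the largest letter to be stripped without changing the earlier counts.\<close>

lemma tail_count_filter:
  assumes "P a" and "P b"
  shows "tail_count a b (filter P w) = tail_count a b w"
proof -
  have "count_list (filter P w) b = count_list w b" for w
    using assms by (induction w) auto
  with assms show ?thesis
    by (induction w) (auto simp: tail_count_Cons tail_count_notin)
qed

text \<open>Only a swap of \<open>i\<close> with \<open>Suc i\<close> could matter. The first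
  relation never swaps consecutive integers; the second leaves an \<open>i\<close> further right, so
  the swap happens before the last \<open>i\<close>.\<close>

lemma tail_count_step:
  "hyposylvester_step u v \<Longrightarrow> tail_count i (Suc i) u = tail_count i (Suc i) v"
  by (induction rule: hyposylvester_step.induct)
    (auto simp: tail_count_append tail_count_Cons)

lemma tail_count_hypo_equiv:
  "u \<approx> v \<Longrightarrow> tail_count i (Suc i) u = tail_count i (Suc i) v"
  by (induction rule: equivclp_induct) (auto dest: tail_count_step simp: tail_count_step)

lemma filter_eq_replicate_count: "filter ((=) a) w = replicate (count_list w a) a"
  by (induction w) auto

text \<open>The word is cut at its last \<open>b\<close>, which is the later copy for moves to the
  front and the witness for moves to the back.\<close>

lemma push_max_to_ends:
  assumes "\<And>a. a \<in> set w \<Longrightarrow> a \<le> Suc b" and "b \<in> set w"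
  defines "k \<equiv> tail_count b (Suc b) w"
  shows "w \<approx> replicate (count_list w (Suc b) - k) (Suc b) @ filter ((\<noteq>) (Suc b)) w
    @ replicate k (Suc b)"
proof -
  obtain u v where w: "w = u @ b # v" and v: "b \<notin> set v"
    using split_list_last[OF assms(2)] by blast
  let ?f = "filter ((=) (Suc b))" and ?g = "filter ((\<noteq>) (Suc b))"
  have k: "k = count_list v (Suc b)"
    using v by (simp add: k_def w tail_count_append tail_count_Cons)
  have "w \<approx> ?f u @ ?g u @ b # v"
    unfolding w by (rule push_max_to_front) (use assms(1) w in auto)
  also have "?f u @ ?g u @ b # v \<approx> ?f u @ ?g u @ b # ?g v @ ?f v"
    using push_max_to_back[of v b "?f u @ ?g u @ [b]"] assms(1) w v by simp
  finally (equivclp_trans) show ?thesis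
    by (simp add: w k filter_eq_replicate_count)
qed

section \<open>Canonical representatives\<close>

lemma m_permutations_filter_max:
  "w \<in> m_permutations m (Suc n) \<Longrightarrow> filter ((\<noteq>) (Suc n)) w \<in> m_permutations m n"
proof -
  assume w: "w \<in> m_permutations m (Suc n)"
  have "i \<noteq> Suc n \<Longrightarrow> count_list (filter ((\<noteq>) (Suc n)) w) i = count_list w i" for i
    by (induction w) auto
  with w show ?thesis by (fastforce simp: m_permutations_def le_Suc_eq)
qed

lemma m_permutations_words: "m_permutations m n \<subseteq> words"
  by (auto simp: m_permutations_def words_def)

text \<open>\<^term>\<open>canon m k n\<close> is a word over \<open>{1..n + 1}\<close>; \<open>k j\<close> counts the letters \<open>j + 2\<close> after the
  last \<open>j + 1\<close>.\<close>

primrec canon :: "nat \<Rightarrow> (nat \<Rightarrow> nat) \<Rightarrow> nat \<Rightarrow> nat list" where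
  "canon m k 0 = replicate m 1"
| "canon m k (Suc n) =
    replicate (m - k n) (Suc (Suc n)) @ canon m k n @ replicate (k n) (Suc (Suc n))"

lemma canon_cong: "(\<And>j. j < n \<Longrightarrow> k j = k' j) \<Longrightarrow> canon m k n = canon m k' n"
  by (induction n) auto

lemma count_list_replicate: "count_list (replicate p a) b = (if a = b then p else 0)"
  by (induction p) auto

text \<open>The bound on \<open>k\<close> makes the truncated difference exact, so both blocks
  together have \<open>m\<close> letters.\<close>

lemma canon_m_permutation:
  assumes "\<And>j. j < n \<Longrightarrow> k j \<le> m"
  shows "canon m k n \<in> m_permutations m (Suc n)"
  using assms
proof (induction n)
  case 0
  show ?case by (auto simp: m_permutations_def count_list_replicate)
next
  case (Suc n)
  then have IH: "canon m k n \<in> m_permutations m (Suc n)" by simp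
  then have "count_list (canon m k n) (Suc (Suc n)) = 0"
    by (auto simp: m_permutations_def count_list_0_iff)
  with IH Suc.prems[of n] show ?case
    by (fastforce simp: m_permutations_def count_list_replicate le_Suc_eq)
qed

lemma tail_count_canon:
  assumes "m \<ge> 1" and "\<And>j. j < n \<Longrightarrow> k j \<le> m" and "j < n"
  shows "tail_count (Suc j) (Suc (Suc j)) (canon m k n) = k j"
  using assms
proof (induction n)
  case 0
  then show ?case by simp
next
  case (Suc n)
  let ?c = "canon m k n"
  have perm: "?c \<in> m_permutations m (Suc n)"
    by (rule canon_m_permutation) (use Suc.prems in auto)
  then have max: "Suc (Suc n) \<notin> set ?c"
    by (auto simp: m_permutations_def)
  show ?case
  proof (cases "j = n")
    case True
    \<comment> \<open>Since \<open>m\<close> is positive, the last \<open>Suc n\<close> lies in the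
      inner word, and exactly the appended block of \<open>k n\<close> letters counts.\<close>
    have "Suc n \<in> set ?c"
      using perm Suc.prems(1) count_list_0_iff[of ?c "Suc n"]
      by (auto simp: m_permutations_def)
    with max have "tail_count (Suc n) (Suc (Suc n)) ?c = 0"
      by (auto simp: tail_count_def count_list_0_iff dest: set_takeWhileD)
    then show ?thesis
      using True \<open>Suc n \<in> set ?c\<close> by (simp add: tail_count_append count_list_replicate)
  next
    case False
    \<comment> \<open>The outermost letter exceeds both letters being compared, so deleting it
      reduces to the inner word.\<close>
    have "filter ((\<noteq>) (Suc (Suc n))) ?c = ?c"
      using max by (auto intro: filter_True)
    then have "filter ((\<noteq>) (Suc (Suc n))) (canon m k (Suc n)) = ?c"
      by simp
    with tail_count_filter[of "(\<noteq>) (Suc (Suc n))" "Suc j" "Suc (Suc j)" "canon m k (Suc n)"]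
    show ?thesis using False Suc by simp
  qed
qed

lemma hypo_equiv_canon:
  assumes "m \<ge> 1" and "w \<in> m_permutations m (Suc n)"
  shows "w \<approx> canon m (\<lambda>j. tail_count (Suc j) (Suc (Suc j)) w) n"
  using assms(2)
proof (induction n arbitrary: w)
  case 0
  then have "w = replicate m 1"
    using filter_eq_replicate_count[of 1 w] filter_True[of w "(=) 1"]
    by (force simp: m_permutations_def)
  then show ?case by simp
next
  case (Suc n)
  let ?k = "\<lambda>w j. tail_count (Suc j) (Suc (Suc j)) w"
  let ?v = "filter ((\<noteq>) (Suc (Suc n))) w"
  let ?p = "replicate (m - ?k w n) (Suc (Suc n))" and ?q = "replicate (?k w n) (Suc (Suc n))"
  have "Suc n \<in> set w"
    using Suc.prems assms(1) count_list_0_iff[of w "Suc n"]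
    by (auto simp: m_permutations_def)
  then have "w \<approx> ?p @ ?v @ ?q"
    using push_max_to_ends[of w "Suc n"] Suc.prems by (fastforce simp: m_permutations_def)
  also have "?p @ ?v @ ?q \<approx> ?p @ canon m (?k ?v) n @ ?q"
    by (intro hypo_equiv_context Suc.IH m_permutations_filter_max Suc.prems)
  finally (equivclp_trans) have "w \<approx> ?p @ canon m (?k ?v) n @ ?q" .
  moreover have "canon m (?k ?v) n = canon m (?k w) n"
    by (intro canon_cong tail_count_filter) auto
  ultimately show ?case by simp
qed

section \<open>Counting the classes\<close>

lemma tail_count_le: "tail_count a b w \<le> count_list w b"
proof -
  have "count_list (rev w) b = count_list (takeWhile ((\<noteq>) a) (rev w)) b
      + count_list (dropWhile ((\<noteq>) a) (rev w)) b"
    by (metis count_list_append takeWhile_dropWhile_id)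
  then show ?thesis by (simp add: tail_count_def)
qed

theorem corollary4p7:
  fixes m n :: nat
  assumes "m \<ge> 1" and "n \<ge> 1"
  shows "card (m_permutations m n // hyposylvester) = (m + 1) ^ (n - 1)"
proof -
  obtain l where n: "n = Suc l" using assms(2) by (cases n) auto
  \<comment> \<open>One value in \<open>{..m}\<close> for each of the \<open>l = n - 1\<close> pairs
    of consecutive letters; extensionality makes the parameter unique.\<close>
  let ?K = "{..<l} \<rightarrow>\<^sub>E {..m}"
  let ?h = "\<lambda>k. hyposylvester `` {canon m k l}"
  have canon: "canon m k l \<in> m_permutations m n" if "k \<in> ?K" for k
    unfolding n by (rule canon_m_permutation) (use that in auto)
  have "m_permutations m n // hyposylvester = ?h ` ?K"
  proof
    show "?h ` ?K \<subseteq> m_permutations m n // hyposylvester"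
      using canon by (auto intro: quotientI)
    show "m_permutations m n // hyposylvester \<subseteq> ?h ` ?K"
    proof
      fix X assume "X \<in> m_permutations m n // hyposylvester"
      then obtain w where w: "w \<in> m_permutations m n" and X: "X = hyposylvester `` {w}"
        by (rule quotientE)
      define k where "k = restrict (\<lambda>j. tail_count (Suc j) (Suc (Suc j)) w) {..<l}"
      have "tail_count (Suc j) (Suc (Suc j)) w \<le> m" if "j < l" for j
        using tail_count_le[of "Suc j" "Suc (Suc j)" w] w that by (auto simp: m_permutations_def n)
      then have k: "k \<in> ?K" by (auto simp: k_def)
      have "canon m k l = canon m (\<lambda>j. tail_count (Suc j) (Suc (Suc j)) w) l"
        by (rule canon_cong) (simp add: k_def)
      with hypo_equiv_canon[OF assms(1)] w have "w \<approx> canon m k l" by (simp add: n)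
      with w canon[OF k] have "(w, canon m k l) \<in> hyposylvester"
        using m_permutations_words by (auto simp: hyposylvester_def)
      then show "X \<in> ?h ` ?K"
        using k X equiv_class_eq[OF equiv_hyposylvester] by blast
    qed
  qed
  \<comment> \<open>The invariants recover the values of \<open>k\<close> from the class of its
    canonical word.\<close>
  moreover have "inj_on ?h ?K"
  proof (rule inj_onI)
    fix k k' assume k: "k \<in> ?K" and k': "k' \<in> ?K" and eq: "?h k = ?h k'"
    have "canon m k' l \<in> words"
      using canon[OF k'] m_permutations_words by blast
    with eq_equiv_class[OF eq equiv_hyposylvester] have "canon m k l \<approx> canon m k' l"
      by (simp add: hyposylvester_def)
    then have "tail_count (Suc j) (Suc (Suc j)) (canon m k l)
        = tail_count (Suc j) (Suc (Suc j)) (canon m k' l)" for j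
      by (rule tail_count_hypo_equiv)
    moreover have "tail_count (Suc j) (Suc (Suc j)) (canon m k l) = k j"
      if "k \<in> ?K" "j < l" for k j
      using that by (intro tail_count_canon assms(1)) auto
    ultimately have "k j = k' j" if "j < l" for j
      using k k' that by metis
    with k k' show "k = k'" by (auto intro: PiE_ext)
  qed
  ultimately show ?thesis
    by (simp add: card_image card_PiE n)
qed

end
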